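(* Let $G$ be a finitely generated residually finite group and let $\phi:G\to G$ be an automorphism such that $R(\phi^n)<\infty$ for all $n\ge 1$. Then for every $n\ge 1$ $$\sum_{d\mid n}\mu(d)\, R(\phi^{n/d})\equiv 0 \pmod n,$$ where $\mu$ is the Möbius function.
   Context: For an automorphism $\psi$ of a (discrete) group $G$, two elements $g,g'\in G$ are twisted conjugate if $g'=xg\psi(x^{-1})$ for some $x\in G$; $R(\psi)$ denotes the number of equivalence classes (Reidemeister classes). $\phi^n$ is the $n$-th iterate of $\phi$. *)

theory Defs
  imports "HOL-Algebra.Algebra" "HOL-Number_Theory.Number_Theory"
    "HOL-Computational_Algebra.Squarefree"
begin

definition finitely_generated_group :: "('a, 'b) monoid_scheme \<Rightarrow> bool" where
  "finitely_generated_group G \<longleftrightarrow>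
     group G \<and> (\<exists>S. finite S \<and> S \<subseteq> carrier G \<and> generate G S = carrier G)"

definition residually_finite_group :: "('a, 'b) monoid_scheme \<Rightarrow> bool" where
  "residually_finite_group G \<longleftrightarrow>
     group G \<and>
     (\<forall>g \<in> carrier G. g \<noteq> \<one>\<^bsub>G\<^esub> \<longrightarrow>
        (\<exists>N. N \<lhd> G \<and> finite (rcosets\<^bsub>G\<^esub> N) \<and> g \<notin> N))"

definition twisted_conj_rel :: "('a, 'b) monoid_scheme \<Rightarrow> ('a \<Rightarrow> 'a) \<Rightarrow> ('a \<times> 'a) set" where
  "twisted_conj_rel G \<psi> =
     {(g, g'). g \<in> carrier G \<and> g' \<in> carrier G \<and>
        (\<exists>x \<in> carrier G. g' = x \<otimes>\<^bsub>G\<^esub> g \<otimes>\<^bsub>G\<^esub> \<psi> (inv\<^bsub>G\<^esub> x))}"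

definition reidemeister_classes :: "('a, 'b) monoid_scheme \<Rightarrow> ('a \<Rightarrow> 'a) \<Rightarrow> 'a set set" where
  "reidemeister_classes G \<psi> = carrier G // twisted_conj_rel G \<psi>"

text \<open>The value is 0, and carries no information, if there are infinitely many classes.\<close>

definition reidemeister_number :: "('a, 'b) monoid_scheme \<Rightarrow> ('a \<Rightarrow> 'a) \<Rightarrow> nat" where
  "reidemeister_number G \<psi> = card (reidemeister_classes G \<psi>)"

definition moebius :: "nat \<Rightarrow> int" where
  "moebius n = (if squarefree n then (-1) ^ card (prime_factors n) else 0)"

lemma equiv_twisted_conj_rel:
  assumes "group G" and "\<psi> \<in> hom G G"
  shows "equiv (carrier G) (twisted_conj_rel G \<psi>)"
proof -
  interpret group G by fact
  interpret h: group_hom G G \<psi>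
    using assms by (simp add: group_hom_def group_hom_axioms_def)
  show ?thesis
  proof (rule equivI)
    show "twisted_conj_rel G \<psi> \<subseteq> carrier G \<times> carrier G"
      by (auto simp: twisted_conj_rel_def)
    show "refl_on (carrier G) (twisted_conj_rel G \<psi>)"
      by (auto simp: refl_on_def twisted_conj_rel_def intro!: bexI[of _ "\<one>\<^bsub>G\<^esub>"])
    show "sym (twisted_conj_rel G \<psi>)"
    proof (rule symI)
      fix g k assume "(g, k) \<in> twisted_conj_rel G \<psi>"
      then obtain x where x: "x \<in> carrier G" "g \<in> carrier G" "k \<in> carrier G"
        "k = x \<otimes>\<^bsub>G\<^esub> g \<otimes>\<^bsub>G\<^esub> \<psi> (inv\<^bsub>G\<^esub> x)"
        by (auto simp: twisted_conj_rel_def)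
      have cancel: "inv\<^bsub>G\<^esub> x \<otimes>\<^bsub>G\<^esub> (x \<otimes>\<^bsub>G\<^esub> z) = z" if "z \<in> carrier G" for z
        using that x(1) by (simp add: m_assoc[symmetric])
      have "inv\<^bsub>G\<^esub> x \<otimes>\<^bsub>G\<^esub> k \<otimes>\<^bsub>G\<^esub> \<psi> (inv\<^bsub>G\<^esub> (inv\<^bsub>G\<^esub> x)) =
            (inv\<^bsub>G\<^esub> x \<otimes>\<^bsub>G\<^esub> x) \<otimes>\<^bsub>G\<^esub> g \<otimes>\<^bsub>G\<^esub> (\<psi> (inv\<^bsub>G\<^esub> x) \<otimes>\<^bsub>G\<^esub> \<psi> x)"
        unfolding x(4) using x(1-2) by (simp add: m_assoc cancel)
      also have "\<dots> = g"
        using x(1-2) by simp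
      finally show "(k, g) \<in> twisted_conj_rel G \<psi>"
        using x(2-3) inv_closed[OF x(1)] unfolding twisted_conj_rel_def by blast
    qed
    show "trans (twisted_conj_rel G \<psi>)"
    proof (rule transI)
      fix g k l assume "(g, k) \<in> twisted_conj_rel G \<psi>" "(k, l) \<in> twisted_conj_rel G \<psi>"
      then obtain x y where xy: "x \<in> carrier G" "y \<in> carrier G" "g \<in> carrier G" "l \<in> carrier G"
        "l = y \<otimes>\<^bsub>G\<^esub> (x \<otimes>\<^bsub>G\<^esub> g \<otimes>\<^bsub>G\<^esub> \<psi> (inv\<^bsub>G\<^esub> x)) \<otimes>\<^bsub>G\<^esub> \<psi> (inv\<^bsub>G\<^esub> y)"
        by (auto simp: twisted_conj_rel_def)
      have "l = (y \<otimes>\<^bsub>G\<^esub> x) \<otimes>\<^bsub>G\<^esub> g \<otimes>\<^bsub>G\<^esub> \<psi> (inv\<^bsub>G\<^esub> (y \<otimes>\<^bsub>G\<^esub> x))"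
        unfolding xy(5) using xy(1-3)
        by (simp add: m_assoc inv_mult_group del: h.hom_inv)
      then show "(g, l) \<in> twisted_conj_rel G \<psi>"
        using xy(1-4) m_closed[OF xy(2,1)] unfolding twisted_conj_rel_def by blast
    qed
  qed
qed

end

theory Submission
  imports Defs
begin

text \<open>Write \<open>t\<close> for the generator acting by \<open>\<phi>\<close> in the mapping torus of \<open>\<phi>\<close>, so that the Reidemeister
  classes of \<open>\<phi>\<^sup>n\<close> are the orbits of \<open>G\<close> acting by conjugation on the coset \<open>G t\<^sup>n\<close>.

  The stabilizers of these actions are finite: in a finite quotient to which \<open>\<phi>\<^sup>n\<close> descends, the
  reciprocals of the stabilizer orders over all classes sum to 1 and there are at most
  \<open>R(\<phi>\<^sup>n)\<close> of them, which bounds every stabilizer order independently of the quotient; residual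
  finiteness and finite generation provide enough such quotients.

  Let \<open>d\<close> divide \<open>n\<close>. The commuting pairs in \<open>G t\<^sup>d \<times> G t\<^sup>n\<close> are counted up to conjugation, with
  weight the reciprocal of the stabilizer order. The elements of \<open>G t\<^sup>n\<close> commuting with \<open>w \<in> G t\<^sup>d\<close>
  are the products of elements of the centralizer of \<open>w\<close> in \<open>G\<close> with the power \<open>n/d\<close> of \<open>w\<close>, so
  that the total weight is \<open>R(\<phi>\<^sup>d)\<close>. The elements of \<open>G t\<^sup>d\<close> commuting with
  \<open>u \<in> G t\<^sup>n\<close> form a coset of the centralizer of \<open>u\<close>, or the empty set; they exist precisely if
  \<open>\<phi>\<^sup>d\<close> fixes the class of \<open>u\<close>. Hence \<open>R(\<phi>\<^sup>d)\<close> is the number of Reidemeister classes of \<open>\<phi>\<^sup>n\<close> fixed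
  by \<open>\<phi>\<^sup>d\<close>. As \<open>\<phi>\<close> permutes these classes with \<open>n\<close>-th power the identity, the congruence is
  the one for the numbers of fixed points of iterates of a permutation.\<close>

section \<open>Gauss congruences for permutations\<close>

lemma squarefree_prime_mult_iff:
  fixes p d :: nat
  assumes "Factorial_Ring.prime p" "\<not> p dvd d"
  shows "squarefree (p * d) \<longleftrightarrow> squarefree d"
proof
  show "squarefree (p * d) \<Longrightarrow> squarefree d" by (rule squarefree_mono[of d "p * d"]) simp
next
  assume "squarefree d"
  have "coprime p d" using assms by (simp add: prime_imp_coprime)
  with \<open>squarefree d\<close> show "squarefree (p * d)"
    using assms by (intro squarefree_mult_coprime) (auto simp: squarefree_prime)
qed

lemma moebius_prime_mult:
  assumes p: "Factorial_Ring.prime p" and nd: "\<not> p dvd d" and d: "d > 0"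
  shows "moebius (p * d) = - moebius d"
proof -
  have "prime_factors (p * d) = insert p (prime_factors d)"
    using p d by (subst prime_factors_product) (auto simp: prime_prime_factors)
  moreover have "p \<notin> prime_factors d" using nd by auto
  ultimately show ?thesis
    using squarefree_prime_mult_iff[OF p nd] by (simp add: moebius_def)
qed

text \<open>Only squarefree divisors contribute. For a prime \<open>p\<close> dividing
  \<open>m\<close>, multiplication by \<open>p\<close> pairs those prime to \<open>p\<close> with
  those divisible by \<open>p\<close>, and the two values in each pair cancel.\<close>

lemma sum_moebius_divisors:
  assumes "m > 0"
  shows "(\<Sum>d | d dvd m. moebius d) = (if m = 1 then 1 else 0)"
proof (cases "m = 1")
  case True
  then show ?thesis by (simp add: moebius_def)
next
  case False
  then obtain p where p: "Factorial_Ring.prime p" "p dvd m" using prime_factor_nat by blast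
  define S where "S = {d. d dvd m \<and> squarefree d}"
  define S0 where "S0 = {d \<in> S. \<not> p dvd d}"
  have fin: "finite {d. d dvd m}" using assms by simp
  have finS: "finite S" using fin unfolding S_def by (rule rev_finite_subset) auto
  have split: "S = S0 \<union> (*) p ` S0"
  proof (intro equalityI subsetI)
    fix d assume d: "d \<in> S"
    show "d \<in> S0 \<union> (*) p ` S0"
    proof (cases "p dvd d")
      case True
      then obtain e where e: "d = p * e" by auto
      have "\<not> p dvd e"
      proof
        assume "p dvd e"
        then have "p ^ 2 dvd d" using e by (auto simp: power2_eq_square)
        then have "is_unit p" using d unfolding S_def squarefree_def by blast
        then show False using p by simp
      qed
      moreover have "e dvd m" using d e unfolding S_def by (auto intro: dvd_mult_right)
      moreover have "squarefree e" using d e unfolding S_def by (auto intro: squarefree_mono[of e "p * e"])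
      ultimately have "e \<in> S0" by (simp add: S0_def S_def)
      then show ?thesis using e by blast
    qed (use d in \<open>auto simp: S0_def\<close>)
  next
    fix d assume "d \<in> S0 \<union> (*) p ` S0"
    then consider "d \<in> S0" | e where "e \<in> S0" "d = p * e" by blast
    then show "d \<in> S"
    proof cases
      case 1 then show ?thesis by (simp add: S0_def)
    next
      case 2
      then have e: "\<not> p dvd e" "e dvd m" "squarefree e" by (auto simp: S0_def S_def)
      have "coprime p e" using e(1) p by (simp add: prime_imp_coprime)
      then have "p * e dvd m" using p e by (simp add: divides_mult)
      then show ?thesis using squarefree_prime_mult_iff[OF p(1) e(1)] e 2 by (simp add: S_def)
    qed
  qed
  have pos: "d > 0" if "d \<in> S0" for d using that assms by (auto simp: S0_def S_def intro: Nat.gr0I)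
  have "(\<Sum>d | d dvd m. moebius d) = (\<Sum>d\<in>S. moebius d)"
    by (rule sum.mono_neutral_right) (use fin in \<open>auto simp: S_def moebius_def\<close>)
  also have "\<dots> = (\<Sum>d\<in>S0. moebius d) + (\<Sum>d\<in>(*) p ` S0. moebius d)"
    unfolding split by (rule sum.union_disjoint) (use finS in \<open>auto simp: S0_def\<close>)
  also have "(\<Sum>d\<in>(*) p ` S0. moebius d) = (\<Sum>d\<in>S0. moebius (p * d))"
    by (subst sum.reindex) (use p in \<open>auto simp: inj_on_def\<close>)
  also have "\<dots> = (\<Sum>d\<in>S0. - moebius d)"
    by (rule sum.cong) (use p pos in \<open>auto simp: moebius_prime_mult S0_def\<close>)
  finally show ?thesis using False by (simp add: sum_negf)
qed

section \<open>Cycles and least periods\<close>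

lemma funpow_closed: "f ` A \<subseteq> A \<Longrightarrow> x \<in> A \<Longrightarrow> (f ^^ k) x \<in> A"
  by (induction k) auto

text \<open>These points fall into disjoint cycles of exactly \<open>n\<close> elements. Since
  \<open>f\<close> is not assumed injective, that orbits which meet coincide is derived from the
  fact that every point of \<open>?Y\<close> is reached again from each of its iterates.\<close>

lemma card_points_of_least_period:
  fixes f :: "'a \<Rightarrow> 'a"
  assumes fin: "finite A" and fX: "f ` A \<subseteq> A" and n: "n > 0"
  shows "n dvd card {x \<in> A. (f ^^ n) x = x \<and> (\<forall>k. 0 < k \<and> k < n \<longrightarrow> (f ^^ k) x \<noteq> x)}"
    (is "n dvd card ?Y")
proof -
  define orb where "orb x = (\<lambda>k. (f ^^ k) x) ` {..<n}" for x
  have period: "(f ^^ k) x = (f ^^ (k mod n)) x" if "x \<in> ?Y" for x k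
    using that by (simp add: funpow_mod_eq)
  have orb_eq: "orb x = range (\<lambda>k. (f ^^ k) x)" if "x \<in> ?Y" for x
  proof
    have "(f ^^ k) x \<in> orb x" for k
      unfolding orb_def by (subst period[OF that]) (use n in simp)
    then show "range (\<lambda>k. (f ^^ k) x) \<subseteq> orb x" by blast
  qed (auto simp: orb_def)
  have return: "\<exists>l. (f ^^ (l + k)) x = x" if "x \<in> ?Y" for x k
  proof
    \<comment> \<open>The exponent \<open>n * k - k\<close> completes \<open>k\<close> steps to a
      multiple of the period; the subtraction is exact because \<open>n\<close> is positive.\<close>
    have "(n * k - k) + k = n * k" using n by simp
    then show "(f ^^ ((n * k - k) + k)) x = x" using period[OF that, of "n * k"] by simp
  qed
  have inY: "(f ^^ k) x \<in> ?Y" if x: "x \<in> ?Y" for x k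
  proof -
    have comm: "(f ^^ a) ((f ^^ b) x) = (f ^^ b) ((f ^^ a) x)" for a b
      by (metis add.commute comp_apply funpow_add)
    obtain l where l: "(f ^^ (l + k)) x = x" using return[OF x] by blast
    \<comment> \<open>Applying \<open>f ^^ l\<close>, which leads back to \<open>x\<close>, turns a
      period of an iterate into a period of \<open>x\<close>; hence no shorter period appears along
      the orbit.\<close>
    have "(f ^^ j) x = x" if "(f ^^ j) ((f ^^ k) x) = (f ^^ k) x" for j
    proof -
      have "(f ^^ j) x = (f ^^ j) ((f ^^ l) ((f ^^ k) x))" using l by (simp add: funpow_add)
      also have "\<dots> = (f ^^ l) ((f ^^ j) ((f ^^ k) x))"
        by (metis add.commute comp_apply funpow_add)
      also have "\<dots> = x" using that l by (simp add: funpow_add)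
      finally show ?thesis .
    qed
    moreover have "(f ^^ n) ((f ^^ k) x) = (f ^^ k) x" using x comm[of n k] by simp
    moreover have "(f ^^ k) x \<in> A" using x funpow_closed[OF fX] by blast
    ultimately show ?thesis using x by blast
  qed
  have inj: "inj_on (\<lambda>k. (f ^^ k) x) {..<n}" if x: "x \<in> ?Y" for x
  proof (rule linorder_inj_onI)
    fix a b assume ab: "a < b" "a \<in> {..<n}" "b \<in> {..<n}"
    let ?z = "(f ^^ a) x"
    have "(f ^^ (b - a)) ?z \<noteq> ?z" using inY[OF x, of a] ab by auto
    moreover have "(f ^^ (b - a)) ?z = (f ^^ b) x"
      using ab by (metis comp_apply funpow_add le_add_diff_inverse2 less_imp_le_nat)
    ultimately show "(f ^^ a) x \<noteq> (f ^^ b) x" by metis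
  qed auto
  have "\<Union> (orb ` ?Y) = ?Y"
  proof
    show "\<Union> (orb ` ?Y) \<subseteq> ?Y" unfolding orb_def using inY by blast
    show "?Y \<subseteq> \<Union> (orb ` ?Y)" unfolding orb_def using n by (force intro: image_eqI[of _ _ 0])
  qed
  moreover have "n dvd card (\<Union> (orb ` ?Y))"
  proof (rule dvd_partition)
    show "\<forall>c\<in>orb ` ?Y. n dvd card c" unfolding orb_def using inj by (auto simp: card_image)
    have sub: "orb ((f ^^ k) x) = orb x" if x: "x \<in> ?Y" for x k
    proof -
      obtain l where l: "(f ^^ (l + k)) x = x" using return[OF x] by blast
      have "(f ^^ j) x \<in> range (\<lambda>i. (f ^^ i) ((f ^^ k) x))" for j
      proof
        have "(f ^^ (j + l)) ((f ^^ k) x) = (f ^^ j) ((f ^^ (l + k)) x)" by (simp add: funpow_add)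
        then show "(f ^^ j) x = (f ^^ (j + l)) ((f ^^ k) x)" using l by simp
      qed simp
      moreover have "(f ^^ i) ((f ^^ k) x) \<in> range (\<lambda>j. (f ^^ j) x)" for i
        by (metis comp_apply funpow_add rangeI)
      ultimately show ?thesis unfolding orb_eq[OF x] orb_eq[OF inY[OF x]] by blast
    qed
    show "\<forall>c1\<in>orb ` ?Y. \<forall>c2\<in>orb ` ?Y. c1 \<noteq> c2 \<longrightarrow> c1 \<inter> c2 = {}"
    proof (intro ballI impI)
      fix c1 c2 assume "c1 \<in> orb ` ?Y" "c2 \<in> orb ` ?Y" and ne: "c1 \<noteq> c2"
      then obtain x y where xy: "x \<in> ?Y" "c1 = orb x" "y \<in> ?Y" "c2 = orb y" by blast
      have "z \<notin> c2" if z1: "z \<in> c1" for z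
      proof
        assume "z \<in> c2"
        then obtain j where "z = (f ^^ j) y" unfolding xy orb_def by blast
        moreover obtain k where "z = (f ^^ k) x" using z1 unfolding xy orb_def by blast
        ultimately have "orb x = orb y" using sub[OF xy(1), of k] sub[OF xy(3), of j] by simp
        then show False using ne xy by simp
      qed
      then show "c1 \<inter> c2 = {}" by blast
    qed
  qed (use fin in \<open>auto simp: orb_def\<close>)
  ultimately show ?thesis by simp
qed

text \<open>Interchanging the sums reduces the claim to a single point. If its least period is
  \<open>p\<close>, then \<open>f ^^ (n div d)\<close> fixes it precisely for the \<open>d\<close>
  dividing \<open>n / p\<close>, so the Moebius sum is 1 for \<open>p = n\<close> and 0 otherwise.
  What remains is the number of points of least period \<open>n\<close>.\<close>

lemma gauss_congruence_permutation:
  fixes f :: "'a \<Rightarrow> 'a"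
  assumes fin: "finite A" and fX: "f ` A \<subseteq> A" and n: "n > 0"
    and per: "\<And>x. x \<in> A \<Longrightarrow> (f ^^ n) x = x"
  shows "[(\<Sum>d | d dvd n. moebius d * int (card {x \<in> A. (f ^^ (n div d)) x = x})) = 0] (mod int n)"
proof -
  define p where "p x = (LEAST k. 0 < k \<and> (f ^^ k) x = x)" for x
  have p: "0 < p x" "(f ^^ p x) x = x" if "x \<in> A" for x
    using LeastI[of "\<lambda>k. 0 < k \<and> (f ^^ k) x = x" n] n per[OF that] by (auto simp: p_def)
  have p_least: "p x \<le> k" if "0 < k" "(f ^^ k) x = x" for x k
    unfolding p_def by (rule Least_le) (use that in simp)
  have p_dvd: "(f ^^ k) x = x \<longleftrightarrow> p x dvd k" if x: "x \<in> A" for x k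
  proof
    assume k: "(f ^^ k) x = x"
    then have "(f ^^ (k mod p x)) x = x" using p(2)[OF x] by (simp add: funpow_mod_eq)
    then have "\<not> 0 < k mod p x"
      using p_least[of "k mod p x" x] mod_less_divisor[OF p(1)[OF x], of k] by linarith
    then show "p x dvd k" by auto
  next
    assume "p x dvd k"
    then have "k mod p x = 0" by simp
    then show "(f ^^ k) x = x" using funpow_mod_eq[OF p(2)[OF x], of k] by simp
  qed
  have inner: "(\<Sum>d | d dvd n. moebius d * of_bool ((f ^^ (n div d)) x = x)) = of_bool (p x = n)"
    if x: "x \<in> A" for x
  proof -
    have pn: "p x dvd n" using p_dvd[OF x] per[OF x] by blast
    then obtain q where q: "n = p x * q" by auto
    have "q > 0" using q n by (auto intro: Nat.gr0I)
    have iff: "p x dvd n div d \<longleftrightarrow> d dvd q" if "d dvd n" for d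
    proof
      assume "p x dvd n div d"
      then obtain e where "n div d = p x * e" by auto
      then have "p x * q = p x * (d * e)" using that q by (metis dvd_mult_div_cancel mult.left_commute)
      then show "d dvd q" using p(1)[OF x] by simp
    next
      assume "d dvd q"
      then obtain e where "q = d * e" by auto
      moreover have "d > 0" using \<open>d dvd n\<close> n by (auto intro: Nat.gr0I)
      ultimately show "p x dvd n div d" using q by simp
    qed
    have "(\<Sum>d | d dvd n. moebius d * of_bool ((f ^^ (n div d)) x = x)) = (\<Sum>d | d dvd q. moebius d)"
      by (rule sum.mono_neutral_cong_right)
        (use n q iff p_dvd[OF x] in \<open>auto intro: dvd_trans simp: of_bool_def\<close>)
    also have "\<dots> = of_bool (p x = n)"
      using sum_moebius_divisors[OF \<open>q > 0\<close>] q n by (auto simp: of_bool_def)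
    finally show ?thesis .
  qed
  have "(\<Sum>d | d dvd n. moebius d * int (card {x \<in> A. (f ^^ (n div d)) x = x}))
      = (\<Sum>d | d dvd n. \<Sum>x\<in>A. moebius d * of_bool ((f ^^ (n div d)) x = x))"
  proof (rule sum.cong)
    fix d
    have "card {x \<in> A. (f ^^ (n div d)) x = x} = (\<Sum>x\<in>A. of_bool ((f ^^ (n div d)) x = x))"
      using fin by (simp add: sum_of_bool_eq Int_def)
    then show "moebius d * int (card {x \<in> A. (f ^^ (n div d)) x = x})
        = (\<Sum>x\<in>A. moebius d * of_bool ((f ^^ (n div d)) x = x))"
      by (simp add: sum_distrib_left)
  qed simp
  also have "\<dots> = (\<Sum>x\<in>A. of_bool (p x = n))"
    by (subst sum.swap) (use inner in simp)
  also have "\<dots> = int (card {x \<in> A. p x = n})"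
    using fin by (simp add: sum_of_bool_eq Int_def)
  also have "{x \<in> A. p x = n} = {x \<in> A. (f ^^ n) x = x \<and> (\<forall>k. 0 < k \<and> k < n \<longrightarrow> (f ^^ k) x \<noteq> x)}"
  proof (intro Collect_cong conj_cong refl)
    fix x assume x: "x \<in> A"
    show "p x = n \<longleftrightarrow> (f ^^ n) x = x \<and> (\<forall>k. 0 < k \<and> k < n \<longrightarrow> (f ^^ k) x \<noteq> x)"
      using p[OF x] p_least[of _ x] per[OF x] n by (metis le_neq_implies_less not_less)
  qed
  finally show ?thesis
    using card_points_of_least_period[OF fin fX n] by (simp add: cong_0_iff)
qed

section \<open>Twisted conjugation and commuting pairs\<close>

text \<open>For an automorphism \<open>\<psi>\<close> this is conjugation of \<open>g t\<close> by
  \<open>x\<close> in the mapping torus, with the factor \<open>t\<close> dropped on the right. The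
  stabilizer below is then the centralizer of \<open>g t\<close> in \<open>G\<close>.\<close>

definition twist :: "('a, 'b) monoid_scheme \<Rightarrow> ('a \<Rightarrow> 'a) \<Rightarrow> 'a \<Rightarrow> 'a \<Rightarrow> 'a" where
  "twist G \<psi> x g = x \<otimes>\<^bsub>G\<^esub> g \<otimes>\<^bsub>G\<^esub> \<psi> (inv\<^bsub>G\<^esub> x)"

definition twisted_stabilizer :: "('a, 'b) monoid_scheme \<Rightarrow> ('a \<Rightarrow> 'a) \<Rightarrow> 'a \<Rightarrow> 'a set" where
  "twisted_stabilizer G \<psi> g = {x \<in> carrier G. twist G \<psi> x g = g}"

text \<open>Stated for endomorphisms because it is also instantiated with the map induced on a
  finite quotient, of which only the homomorphism property is established.\<close>

locale group_endo = group G for G (structure) +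
  fixes \<psi> :: "'a \<Rightarrow> 'a"
  assumes endo: "\<psi> \<in> hom G G"
begin

lemma endo_closed [simp]: "x \<in> carrier G \<Longrightarrow> \<psi> x \<in> carrier G"
  using endo by (auto simp: hom_def)

lemma endo_mult [simp]: "x \<in> carrier G \<Longrightarrow> y \<in> carrier G \<Longrightarrow> \<psi> (x \<otimes> y) = \<psi> x \<otimes> \<psi> y"
  using endo by (auto simp: hom_def)

lemma endo_one [simp]: "\<psi> \<one> = \<one>"
  using endo hom_one[OF endo is_group is_group] by simp

lemma endo_inv [simp]: "x \<in> carrier G \<Longrightarrow> \<psi> (inv x) = inv (\<psi> x)"
  by (rule inv_equality[symmetric]) (simp_all flip: endo_mult)

lemma twist_closed [simp]: "x \<in> carrier G \<Longrightarrow> g \<in> carrier G \<Longrightarrow> twist G \<psi> x g \<in> carrier G"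
  by (simp add: twist_def)

lemma twist_one [simp]: "g \<in> carrier G \<Longrightarrow> twist G \<psi> \<one> g = g"
  by (simp add: twist_def)

lemma twist_mult:
  "x \<in> carrier G \<Longrightarrow> y \<in> carrier G \<Longrightarrow> g \<in> carrier G \<Longrightarrow>
    twist G \<psi> (x \<otimes> y) g = twist G \<psi> x (twist G \<psi> y g)"
  by (simp add: twist_def m_assoc inv_mult_group)

lemma twist_inv_cancel [simp]:
  assumes "x \<in> carrier G" "g \<in> carrier G"
  shows "twist G \<psi> (inv x) (twist G \<psi> x g) = g" "twist G \<psi> x (twist G \<psi> (inv x) g) = g"
  using assms by (simp_all flip: twist_mult)

lemma twisted_conj_rel_iff:
  "(g, h) \<in> twisted_conj_rel G \<psi> \<longleftrightarrow> g \<in> carrier G \<and> (\<exists>x \<in> carrier G. h = twist G \<psi> x g)"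
  using twist_closed by (auto simp: twisted_conj_rel_def twist_def)

lemma twisted_class_eq:
  "g \<in> carrier G \<Longrightarrow> twisted_conj_rel G \<psi> `` {g} = (\<lambda>x. twist G \<psi> x g) ` carrier G"
  by (auto simp: twisted_conj_rel_iff)

lemma equiv_rel: "equiv (carrier G) (twisted_conj_rel G \<psi>)"
  using equiv_twisted_conj_rel[OF is_group endo] .

lemma mem_twisted_stabilizer_iff:
  "x \<in> twisted_stabilizer G \<psi> g \<longleftrightarrow> x \<in> carrier G \<and> x \<otimes> g = g \<otimes> \<psi> x" if "g \<in> carrier G"
proof -
  have "x \<otimes> g \<otimes> inv (\<psi> x) = g \<longleftrightarrow> x \<otimes> g = g \<otimes> \<psi> x" if "x \<in> carrier G"
    using that \<open>g \<in> carrier G\<close> by (metis endo_closed inv_solve_right m_closed)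
  then show ?thesis by (auto simp: twisted_stabilizer_def twist_def)
qed

lemma one_mem_twisted_stabilizer: "g \<in> carrier G \<Longrightarrow> \<one> \<in> twisted_stabilizer G \<psi> g"
  by (simp add: twisted_stabilizer_def)

text \<open>The elements moving \<open>g\<close> to the same point as \<open>y\<close> form the left
  coset of the stabilizer represented by \<open>y\<close>.\<close>

lemma card_transporter:
  assumes g: "g \<in> carrier G" and y: "y \<in> carrier G"
  shows "card {x \<in> carrier G. twist G \<psi> x g = twist G \<psi> y g} = card (twisted_stabilizer G \<psi> g)"
proof -
  have "bij_betw (\<lambda>s. y \<otimes> s) (twisted_stabilizer G \<psi> g)
      {x \<in> carrier G. twist G \<psi> x g = twist G \<psi> y g}"
  proof (rule bij_betwI[where g = "\<lambda>x. inv y \<otimes> x"])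
    show "(\<lambda>s. y \<otimes> s) \<in> twisted_stabilizer G \<psi> g \<rightarrow> {x \<in> carrier G. twist G \<psi> x g = twist G \<psi> y g}"
      using g y by (auto simp: twisted_stabilizer_def twist_mult)
    show "(\<lambda>x. inv y \<otimes> x) \<in> {x \<in> carrier G. twist G \<psi> x g = twist G \<psi> y g} \<rightarrow> twisted_stabilizer G \<psi> g"
      using g y by (auto simp: twisted_stabilizer_def twist_mult)
  qed (use g y in \<open>auto simp: twisted_stabilizer_def m_assoc[symmetric]\<close>)
  then show ?thesis by (simp add: bij_betw_same_card)
qed

text \<open>The later weighted sums run over representatives, since a stabilizer belongs to an
  element and not to a class.\<close>

lemma obtain_transversal:
  obtains W where "W \<subseteq> carrier G"
    "bij_betw (\<lambda>w. twisted_conj_rel G \<psi> `` {w}) W (reidemeister_classes G \<psi>)"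
proof
  define rep where "rep c = (SOME x. x \<in> c)" for c :: "'a set"
  have rep: "rep c \<in> carrier G" "twisted_conj_rel G \<psi> `` {rep c} = c"
    if "c \<in> reidemeister_classes G \<psi>" for c
  proof -
    have c: "c \<in> carrier G // twisted_conj_rel G \<psi>" using that by (simp add: reidemeister_classes_def)
    have "rep c \<in> c" unfolding rep_def
      using in_quotient_imp_non_empty[OF equiv_rel c] by (metis ex_in_conv someI_ex)
    then show "rep c \<in> carrier G" using in_quotient_imp_subset[OF equiv_rel c] by blast
    from c obtain x where x: "c = twisted_conj_rel G \<psi> `` {x}" by (auto elim: quotientE)
    show "twisted_conj_rel G \<psi> `` {rep c} = c"
      using \<open>rep c \<in> c\<close> equiv_class_eq[OF equiv_rel] unfolding x by blast
  qed
  show "rep ` reidemeister_classes G \<psi> \<subseteq> carrier G" using rep by blast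
  show "bij_betw (\<lambda>w. twisted_conj_rel G \<psi> `` {w}) (rep ` reidemeister_classes G \<psi>) (reidemeister_classes G \<psi>)"
    by (rule bij_betw_byWitness[where f' = rep]) (use rep in auto)
qed

lemma transversal_unique:
  assumes W: "W \<subseteq> carrier G"
    "bij_betw (\<lambda>w. twisted_conj_rel G \<psi> `` {w}) W (reidemeister_classes G \<psi>)"
    and x: "x \<in> carrier G"
  shows "\<exists>!w. w \<in> W \<and> (w, x) \<in> twisted_conj_rel G \<psi>"
proof -
  have "twisted_conj_rel G \<psi> `` {x} \<in> reidemeister_classes G \<psi>"
    using x by (simp add: reidemeister_classes_def quotientI)
  then obtain w where w: "w \<in> W" "twisted_conj_rel G \<psi> `` {w} = twisted_conj_rel G \<psi> `` {x}"
    using W(2) by (metis (no_types, lifting) bij_betw_def imageE)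
  have iff: "(v, x) \<in> twisted_conj_rel G \<psi> \<longleftrightarrow> twisted_conj_rel G \<psi> `` {v} = twisted_conj_rel G \<psi> `` {x}"
    if "v \<in> W" for v
    using eq_equiv_class_iff[OF equiv_rel] that x W(1) by blast
  show ?thesis
  proof (rule ex1I)
    show "w \<in> W \<and> (w, x) \<in> twisted_conj_rel G \<psi>" using w iff by blast
    fix v assume "v \<in> W \<and> (v, x) \<in> twisted_conj_rel G \<psi>"
    then show "v = w" using w iff W(2) by (metis (no_types, lifting) bij_betw_inv_into_left)
  qed
qed

text \<open>Split \<open>S\<close> by classes: each point of \<open>S\<close> in the class of
  \<open>w\<close> equals \<open>twist G \<psi> x w\<close> for as many \<open>x\<close> as the
  stabilizer of \<open>w\<close> has elements. The set \<open>S\<close> may cut through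
  classes.\<close>

lemma card_eq_weighted_sum:
  assumes W: "W \<subseteq> carrier G"
    "bij_betw (\<lambda>w. twisted_conj_rel G \<psi> `` {w}) W (reidemeister_classes G \<psi>)"
    and finW: "finite W" and stab: "\<And>w. w \<in> W \<Longrightarrow> finite (twisted_stabilizer G \<psi> w)"
    and S: "finite S" "S \<subseteq> carrier G"
  shows "real (card S) = (\<Sum>w\<in>W. card {x \<in> carrier G. twist G \<psi> x w \<in> S} / card (twisted_stabilizer G \<psi> w))"
proof -
  define T where "T w = {s \<in> S. (w, s) \<in> twisted_conj_rel G \<psi>}" for w
  have pos: "card (twisted_stabilizer G \<psi> w) > 0" if "w \<in> W" for w
    using stab[OF that] one_mem_twisted_stabilizer[of w] that W(1) by (auto simp: card_gt_0_iff)
  have count: "card {x \<in> carrier G. twist G \<psi> x w \<in> S} = card (T w) * card (twisted_stabilizer G \<psi> w)"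
    if w: "w \<in> W" for w
  proof -
    have wG: "w \<in> carrier G" using w W(1) by blast
    have c: "card {x \<in> carrier G. twist G \<psi> x w = s} = card (twisted_stabilizer G \<psi> w)" if "s \<in> T w" for s
    proof -
      obtain y where "y \<in> carrier G" "s = twist G \<psi> y w"
        using \<open>s \<in> T w\<close> by (auto simp: T_def twisted_conj_rel_iff)
      then show ?thesis using card_transporter[OF wG] by simp
    qed
    have "{x \<in> carrier G. twist G \<psi> x w \<in> S} = (\<Union>s\<in>T w. {x \<in> carrier G. twist G \<psi> x w = s})"
      using wG by (auto simp: T_def twisted_conj_rel_iff)
    also have "card \<dots> = (\<Sum>s\<in>T w. card {x \<in> carrier G. twist G \<psi> x w = s})"
      by (rule card_UN_disjoint) (use S c pos[OF w] in \<open>auto simp: T_def intro: card_ge_0_finite\<close>)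
    finally show ?thesis using c by simp
  qed
  have "\<exists>w\<in>W. s \<in> T w" if "s \<in> S" for s
    using transversal_unique[OF W, of s] S(2) that unfolding T_def by blast
  then have "S = (\<Union>w\<in>W. T w)" unfolding T_def by blast
  also have "card \<dots> = (\<Sum>w\<in>W. card (T w))"
  proof (rule card_UN_disjoint)
    show "\<forall>i\<in>W. \<forall>j\<in>W. i \<noteq> j \<longrightarrow> T i \<inter> T j = {}"
      using transversal_unique[OF W] S(2) unfolding T_def by blast
  qed (use finW S in \<open>auto simp: T_def\<close>)
  finally have "real (card S) = (\<Sum>w\<in>W. real (card (T w)))" by simp
  also have "\<dots> = (\<Sum>w\<in>W. card {x \<in> carrier G. twist G \<psi> x w \<in> S} / card (twisted_stabilizer G \<psi> w))"
    using count pos by (intro sum.cong) auto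
  finally show ?thesis .
qed

end

section \<open>Commuting pairs for two commuting endomorphisms\<close>

locale commuting_endos = \<psi>: group_endo G \<psi> + \<chi>: group_endo G \<chi> for G (structure) and \<psi> \<chi> +
  assumes commute: "\<And>x. x \<in> carrier G \<Longrightarrow> \<psi> (\<chi> x) = \<chi> (\<psi> x)"
begin

text \<open>With \<open>\<psi> = \<phi> ^^ d\<close> and \<open>\<chi> = \<phi> ^^ n\<close> this
  says that \<open>w t^d\<close> and \<open>u t^n\<close> commute in the mapping torus of
  \<open>\<phi>\<close>: moving the powers of \<open>t\<close> to the right leaves this equation in
  \<open>G\<close>.\<close>

definition commuting_pair :: "'a \<Rightarrow> 'a \<Rightarrow> bool" where
  "commuting_pair w u \<longleftrightarrow> w \<otimes> \<psi> u = u \<otimes> \<chi> w"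

text \<open>Simultaneous conjugation preserves commuting: both sides of the defining equation are
  multiplied by \<open>x\<close> on the left and by \<open>inv (\<psi> (\<chi> x))\<close> on the
  right.\<close>

lemma commuting_pair_twist:
  assumes x: "x \<in> carrier G" and w: "w \<in> carrier G" and u: "u \<in> carrier G"
  shows "commuting_pair (twist G \<psi> x w) (twist G \<chi> x u) \<longleftrightarrow> commuting_pair w u"
proof -
  have cancel: "inv z \<otimes> (z \<otimes> y) = y" if "z \<in> carrier G" "y \<in> carrier G" for z y
    using that by (simp add: \<psi>.m_assoc[symmetric])
  have "twist G \<psi> x w \<otimes> \<psi> (twist G \<chi> x u) = x \<otimes> (w \<otimes> \<psi> u) \<otimes> inv (\<psi> (\<chi> x))"
    using assms by (simp add: twist_def \<psi>.m_assoc cancel)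
  moreover have "twist G \<chi> x u \<otimes> \<chi> (twist G \<psi> x w) = x \<otimes> (u \<otimes> \<chi> w) \<otimes> inv (\<psi> (\<chi> x))"
    using assms by (simp add: twist_def \<psi>.m_assoc cancel commute)
  ultimately show ?thesis
    using assms by (simp add: commuting_pair_def)
qed

lemma commuting_pair_twist_left:
  assumes x: "x \<in> carrier G" and w: "w \<in> carrier G" and u: "u \<in> carrier G"
  shows "commuting_pair (twist G \<psi> x w) u \<longleftrightarrow> commuting_pair w (twist G \<chi> (inv x) u)"
  using commuting_pair_twist[OF x w, of "twist G \<chi> (inv x) u"] x u by simp

text \<open>Once \<open>u0\<close> commutes with \<open>w\<close>, the product
  \<open>c \<otimes> u0\<close> commutes with \<open>w\<close> if and only if \<open>c\<close>
  centralizes \<open>w\<close>.\<close>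

lemma bij_betw_commuting_right:
  assumes w: "w \<in> carrier G" and u0: "u0 \<in> carrier G" "commuting_pair w u0"
  shows "bij_betw (\<lambda>c. c \<otimes> u0) (twisted_stabilizer G \<psi> w) {u \<in> carrier G. commuting_pair w u}"
proof -
  have iff: "commuting_pair w (c \<otimes> u0) \<longleftrightarrow> c \<in> twisted_stabilizer G \<psi> w" if c: "c \<in> carrier G" for c
  proof -
    have "w \<otimes> \<psi> (c \<otimes> u0) = w \<otimes> \<psi> c \<otimes> \<psi> u0" using w u0 c by (simp add: \<psi>.m_assoc)
    moreover have "c \<otimes> u0 \<otimes> \<chi> w = c \<otimes> w \<otimes> \<psi> u0"
      using w u0 c by (simp add: \<psi>.m_assoc commuting_pair_def)
    ultimately show ?thesis
      using w u0 c by (auto simp: commuting_pair_def \<psi>.mem_twisted_stabilizer_iff)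
  qed
  show ?thesis
  proof (rule bij_betwI[where g = "\<lambda>u. u \<otimes> inv u0"])
    show "(\<lambda>c. c \<otimes> u0) \<in> twisted_stabilizer G \<psi> w \<rightarrow> {u \<in> carrier G. commuting_pair w u}"
      using iff u0 by (auto simp: twisted_stabilizer_def)
    show "(\<lambda>u. u \<otimes> inv u0) \<in> {u \<in> carrier G. commuting_pair w u} \<rightarrow> twisted_stabilizer G \<psi> w"
    proof
      fix u assume "u \<in> {u \<in> carrier G. commuting_pair w u}"
      then show "u \<otimes> inv u0 \<in> twisted_stabilizer G \<psi> w"
        using iff[of "u \<otimes> inv u0"] u0 by (simp add: \<psi>.m_assoc)
    qed
  qed (use u0 in \<open>auto simp: twisted_stabilizer_def \<psi>.m_assoc\<close>)
qed

text \<open>Solving the commuting equation for \<open>\<psi> u\<close> exhibits it as the twist of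
  \<open>u\<close> by \<open>inv w\<close>.\<close>

lemma ex_commuting_left_iff:
  assumes u: "u \<in> carrier G"
  shows "(\<exists>w \<in> carrier G. commuting_pair w u) \<longleftrightarrow> (u, \<psi> u) \<in> twisted_conj_rel G \<chi>"
proof -
  have iff: "commuting_pair w u \<longleftrightarrow> \<psi> u = twist G \<chi> (inv w) u" if w: "w \<in> carrier G" for w
  proof -
    have "twist G \<chi> (inv w) u = inv w \<otimes> (u \<otimes> \<chi> w)" using w u by (simp add: twist_def \<psi>.m_assoc)
    moreover have "\<psi> u = inv w \<otimes> (u \<otimes> \<chi> w) \<longleftrightarrow> u \<otimes> \<chi> w = w \<otimes> \<psi> u"
      using w u by (intro \<psi>.inv_solve_left) auto
    ultimately show ?thesis unfolding commuting_pair_def by metis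
  qed
  show ?thesis
  proof
    assume "\<exists>w \<in> carrier G. commuting_pair w u"
    then obtain w where w: "w \<in> carrier G" "\<psi> u = twist G \<chi> (inv w) u" using iff by blast
    then show "(u, \<psi> u) \<in> twisted_conj_rel G \<chi>"
      unfolding \<chi>.twisted_conj_rel_iff using u \<psi>.inv_closed[OF w(1)] by blast
  next
    assume "(u, \<psi> u) \<in> twisted_conj_rel G \<chi>"
    then obtain x where x: "x \<in> carrier G" "\<psi> u = twist G \<chi> x u"
      unfolding \<chi>.twisted_conj_rel_iff by blast
    then have "commuting_pair (inv x) u" using iff[of "inv x"] by simp
    then show "\<exists>w \<in> carrier G. commuting_pair w u" using x(1) by blast
  qed
qed

end

text \<open>By this symmetry the description of the partners of \<open>w\<close> also yields the
  partners of \<open>u\<close>.\<close>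

lemma (in commuting_endos) commuting_endos_swap: "commuting_endos G \<chi> \<psi>"
  by unfold_locales (simp add: commute)

lemma (in commuting_endos) commuting_pair_swap:
  "commuting_endos.commuting_pair G \<chi> \<psi> u w \<longleftrightarrow> commuting_pair w u"
  using commuting_endos.commuting_pair_def[OF commuting_endos_swap] commuting_pair_def by metis

text \<open>Double counting over transversals of both actions: the number of \<open>x\<close> such that
  \<open>commuting_pair (x \<cdot> w) u\<close> holds, divided by the orders of the two stabilizers, is summed over
  \<open>w\<close> and \<open>u\<close>, and inversion of \<open>x\<close> moves the action from \<open>w\<close> to \<open>u\<close>.\<close>

lemma (in commuting_endos) reidemeister_number_eq_fixed_classes:
  assumes fin: "finite (reidemeister_classes G \<psi>)" "finite (reidemeister_classes G \<chi>)"
    and stab\<psi>: "\<And>g. g \<in> carrier G \<Longrightarrow> finite (twisted_stabilizer G \<psi> g)"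
    and stab\<chi>: "\<And>g. g \<in> carrier G \<Longrightarrow> finite (twisted_stabilizer G \<chi> g)"
    and ex: "\<And>w. w \<in> carrier G \<Longrightarrow> \<exists>u \<in> carrier G. commuting_pair w u"
    and surj: "\<psi> ` carrier G = carrier G"
  shows "reidemeister_number G \<psi> = card {c \<in> reidemeister_classes G \<chi>. \<psi> ` c = c}"
proof -
  interpret swap: commuting_endos G \<chi> \<psi> by (rule commuting_endos_swap)
  note swap_pair = commuting_pair_swap
  obtain W where W: "W \<subseteq> carrier G"
    "bij_betw (\<lambda>w. twisted_conj_rel G \<psi> `` {w}) W (reidemeister_classes G \<psi>)"
    using \<psi>.obtain_transversal .
  obtain U where U: "U \<subseteq> carrier G"
    "bij_betw (\<lambda>u. twisted_conj_rel G \<chi> `` {u}) U (reidemeister_classes G \<chi>)"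
    using \<chi>.obtain_transversal .
  have finW: "finite W" and finU: "finite U"
    using fin bij_betw_finite[OF W(2)] bij_betw_finite[OF U(2)] by auto
  let ?sw = "\<lambda>w. real (card (twisted_stabilizer G \<psi> w))"
  let ?su = "\<lambda>u. real (card (twisted_stabilizer G \<chi> u))"
  let ?R = "\<lambda>w. {u \<in> carrier G. commuting_pair w u}"
  let ?L = "\<lambda>u. {w \<in> carrier G. commuting_pair w u}"
  have pos: "?sw g > 0" "?su g > 0" if "g \<in> carrier G" for g
    using that stab\<psi> stab\<chi> \<psi>.one_mem_twisted_stabilizer[of g] \<chi>.one_mem_twisted_stabilizer[of g]
    by (auto simp: card_gt_0_iff)
  have R: "finite (?R w)" "card (?R w) = ?sw w" if w: "w \<in> carrier G" for w
  proof -
    obtain u0 where "u0 \<in> carrier G" "commuting_pair w u0" using ex[OF w] by blast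
    note b = bij_betw_commuting_right[OF w this]
    show "finite (?R w)" using stab\<psi>[OF w] bij_betw_finite[OF b] by simp
    show "card (?R w) = ?sw w" using bij_betw_same_card[OF b] by simp
  qed
  have L: "finite (?L u)" "card (?L u) = (if (u, \<psi> u) \<in> twisted_conj_rel G \<chi> then ?su u else 0)"
    if u: "u \<in> carrier G" for u
  proof -
    have "finite (?L u) \<and> card (?L u) = (if (u, \<psi> u) \<in> twisted_conj_rel G \<chi> then ?su u else 0)"
    proof (cases "(u, \<psi> u) \<in> twisted_conj_rel G \<chi>")
      case True
      then obtain w0 where "w0 \<in> carrier G" "swap.commuting_pair u w0"
        using ex_commuting_left_iff[OF u] swap_pair by blast
      note b = swap.bij_betw_commuting_right[OF u this, unfolded swap_pair]
      show ?thesis using stab\<chi>[OF u] bij_betw_finite[OF b] bij_betw_same_card[OF b] True by simp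
    next
      case False
      then have "?L u = {}" using ex_commuting_left_iff[OF u] by blast
      then show ?thesis using False by (simp only: finite.emptyI card.empty if_False of_nat_0 simp_thms)
    qed
    then show "finite (?L u)" "card (?L u) = (if (u, \<psi> u) \<in> twisted_conj_rel G \<chi> then ?su u else 0)"
      by auto
  qed
  have transport: "card {x \<in> carrier G. commuting_pair (twist G \<psi> x w) u}
      = card {x \<in> carrier G. commuting_pair w (twist G \<chi> x u)}"
    if "w \<in> carrier G" "u \<in> carrier G" for w u
  proof (rule bij_betw_same_card)
    show "bij_betw (\<lambda>x. inv x) {x \<in> carrier G. commuting_pair (twist G \<psi> x w) u}
        {x \<in> carrier G. commuting_pair w (twist G \<chi> x u)}"
      by (rule bij_betwI[where g = "\<lambda>x. inv x"])
        (use that commuting_pair_twist_left in auto)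
  qed
  have "real (reidemeister_number G \<psi>) = (\<Sum>w\<in>W. 1)"
    using bij_betw_same_card[OF W(2)] by (simp add: reidemeister_number_def)
  \<comment> \<open>Each \<open>w\<close> has weight 1, because \<open>?R w\<close> is nonempty and
    thus a translate of the stabilizer of \<open>w\<close>.\<close>
  also have "\<dots> = (\<Sum>w\<in>W. card (?R w) / ?sw w)"
    using R(2) pos W(1) by (intro sum.cong) (auto simp: less_imp_neq[symmetric] subset_iff)
  also have "\<dots> = (\<Sum>w\<in>W. \<Sum>u\<in>U. card {x \<in> carrier G. commuting_pair w (twist G \<chi> x u)} / ?su u / ?sw w)"
  proof (rule sum.cong)
    fix w assume "w \<in> W"
    then have w: "w \<in> carrier G" using W by blast
    have "{x \<in> carrier G. twist G \<chi> x u \<in> ?R w} = {x \<in> carrier G. commuting_pair w (twist G \<chi> x u)}"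
      if "u \<in> U" for u using that U(1) by auto
    then have "real (card (?R w)) = (\<Sum>u\<in>U. card {x \<in> carrier G. commuting_pair w (twist G \<chi> x u)} / ?su u)"
      using \<chi>.card_eq_weighted_sum[OF U finU stab\<chi> R(1)[OF w]] U(1) by (auto simp: subset_iff)
    then show "card (?R w) / ?sw w
        = (\<Sum>u\<in>U. card {x \<in> carrier G. commuting_pair w (twist G \<chi> x u)} / ?su u / ?sw w)"
      by (simp add: sum_divide_distrib)
  qed simp
  also have "\<dots> = (\<Sum>w\<in>W. \<Sum>u\<in>U. card {x \<in> carrier G. commuting_pair (twist G \<psi> x w) u} / ?sw w / ?su u)"
    using transport W(1) U(1) by (intro sum.cong refl) (auto simp: subset_iff mult.commute)
  also have "\<dots> = (\<Sum>u\<in>U. \<Sum>w\<in>W. card {x \<in> carrier G. commuting_pair (twist G \<psi> x w) u} / ?sw w / ?su u)"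
    by (rule sum.swap)
  also have "\<dots> = (\<Sum>u\<in>U. card (?L u) / ?su u)"
  proof (rule sum.cong)
    fix u assume "u \<in> U"
    then have u: "u \<in> carrier G" using U by blast
    have "{x \<in> carrier G. twist G \<psi> x w \<in> ?L u} = {x \<in> carrier G. commuting_pair (twist G \<psi> x w) u}"
      if "w \<in> W" for w using that W(1) by auto
    then have "real (card (?L u)) = (\<Sum>w\<in>W. card {x \<in> carrier G. commuting_pair (twist G \<psi> x w) u} / ?sw w)"
      using \<psi>.card_eq_weighted_sum[OF W finW stab\<psi> L(1)[OF u]] W(1) by (auto simp: subset_iff)
    then show "(\<Sum>w\<in>W. card {x \<in> carrier G. commuting_pair (twist G \<psi> x w) u} / ?sw w / ?su u)
        = card (?L u) / ?su u"
      by (simp add: sum_divide_distrib)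
  qed simp
  \<comment> \<open>Here the weight is 1 or 0: \<open>?L u\<close> is a translate of the stabilizer
    of \<open>u\<close> if \<open>\<psi>\<close> fixes the class of \<open>u\<close>, and empty
    otherwise.\<close>
  also have "\<dots> = (\<Sum>u\<in>U. of_bool ((u, \<psi> u) \<in> twisted_conj_rel G \<chi>))"
    using L(2) pos U(1) by (intro sum.cong) (auto simp: less_imp_neq[symmetric] subset_iff)
  also have "\<dots> = real (card {u \<in> U. (u, \<psi> u) \<in> twisted_conj_rel G \<chi>})"
    using finU by (simp add: sum_of_bool_eq Int_def)
  finally have "reidemeister_number G \<psi> = card {u \<in> U. (u, \<psi> u) \<in> twisted_conj_rel G \<chi>}"
    by (simp only: of_nat_eq_iff)
  also have "\<dots> = card {c \<in> reidemeister_classes G \<chi>. \<psi> ` c = c}"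
  proof (rule bij_betw_same_card)
    \<comment> \<open>Surjectivity of \<open>\<psi>\<close> makes the image of the class of
      \<open>u\<close> the whole class of \<open>\<psi> u\<close>, so that a fixed class can be
      expressed by equality of sets.\<close>
    have iff: "\<psi> ` (twisted_conj_rel G \<chi> `` {u}) = twisted_conj_rel G \<chi> `` {u} \<longleftrightarrow> (u, \<psi> u) \<in> twisted_conj_rel G \<chi>"
      if u: "u \<in> carrier G" for u
    proof -
      have eq: "\<psi> (twist G \<chi> x u) = twist G \<chi> (\<psi> x) (\<psi> u)" if "x \<in> carrier G" for x
        using that u by (simp add: twist_def commute)
      have "\<psi> ` (twisted_conj_rel G \<chi> `` {u}) = (\<lambda>x. \<psi> (twist G \<chi> x u)) ` carrier G"
        by (simp only: \<chi>.twisted_class_eq[OF u] image_image)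
      also have "\<dots> = (\<lambda>x. twist G \<chi> x (\<psi> u)) ` \<psi> ` carrier G"
        unfolding image_image by (rule image_cong) (simp_all add: eq)
      also have "\<dots> = twisted_conj_rel G \<chi> `` {\<psi> u}"
        using u by (simp add: surj \<chi>.twisted_class_eq)
      finally show ?thesis
        using eq_equiv_class_iff[OF \<chi>.equiv_rel u, of "\<psi> u"] u by auto
    qed
    let ?cl = "\<lambda>u. twisted_conj_rel G \<chi> `` {u}"
    have inj: "inj_on ?cl U" and im: "?cl ` U = reidemeister_classes G \<chi>"
      using U(2) by (auto simp only: bij_betw_def)
    show "bij_betw ?cl {u \<in> U. (u, \<psi> u) \<in> twisted_conj_rel G \<chi>}
        {c \<in> reidemeister_classes G \<chi>. \<psi> ` c = c}"
    proof (rule bij_betw_imageI)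
      show "inj_on ?cl {u \<in> U. (u, \<psi> u) \<in> twisted_conj_rel G \<chi>}"
        by (rule inj_on_subset[OF inj]) blast
      have "{u \<in> U. (u, \<psi> u) \<in> twisted_conj_rel G \<chi>} = {u \<in> U. \<psi> ` ?cl u = ?cl u}"
        using iff U(1) by blast
      then show "?cl ` {u \<in> U. (u, \<psi> u) \<in> twisted_conj_rel G \<chi>}
          = {c \<in> reidemeister_classes G \<chi>. \<psi> ` c = c}"
        unfolding im[symmetric] by blast
    qed
  qed
  finally show ?thesis .
qed

section \<open>Finiteness of twisted stabilizers\<close>

text \<open>Landau's argument, by induction on the number of terms: with at most \<open>r\<close>
  terms, the smallest denominator is at most \<open>r / s\<close>, and deleting its term leaves one
  of finitely many new values of the sum. These values vary, hence the arbitrary real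
  \<open>s\<close>.\<close>

lemma unit_fractions_bounded:
  fixes s :: real
  shows "\<exists>B. \<forall>(f :: 'i \<Rightarrow> nat) A. finite A \<longrightarrow> card A \<le> r \<longrightarrow> (\<forall>a\<in>A. 0 < f a) \<longrightarrow>
    (\<Sum>a\<in>A. 1 / real (f a)) = s \<longrightarrow> (\<forall>a\<in>A. f a \<le> B)"
proof (induction r arbitrary: s)
  case 0
  then show ?case by auto
next
  case (Suc r)
  define P where "P B s \<longleftrightarrow> (\<forall>(f :: 'i \<Rightarrow> nat) A. finite A \<longrightarrow> card A \<le> r \<longrightarrow> (\<forall>a\<in>A. 0 < f a) \<longrightarrow>
    (\<Sum>a\<in>A. 1 / real (f a)) = s \<longrightarrow> (\<forall>a\<in>A. f a \<le> B))" for B and s :: real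
  obtain Bd where Bd: "P (Bd s) s" for s using Suc.IH unfolding P_def by metis
  define m where "m = nat \<lfloor>real (Suc r) / s\<rfloor>"
  show ?case
  proof (intro exI allI impI ballI)
    fix f :: "'i \<Rightarrow> nat" and A a
    assume A: "finite A" "card A \<le> Suc r" and pos: "\<forall>a\<in>A. 0 < f a"
      and s: "(\<Sum>a\<in>A. 1 / real (f a)) = s" and a: "a \<in> A"
    define a0 where "a0 = arg_min_on f A"
    have a0: "a0 \<in> A" "\<And>b. b \<in> A \<Longrightarrow> f a0 \<le> f b"
      unfolding a0_def using arg_min_if_finite[of A f] A(1) a by (auto simp: not_less[symmetric])
    have f0: "0 < f a0" using pos a0 by blast
    have "0 < s" unfolding s[symmetric] using A(1) a pos by (intro sum_pos) auto
    have "s \<le> (\<Sum>b\<in>A. 1 / real (f a0))"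
      unfolding s[symmetric] using a0 f0 by (intro sum_mono) (simp add: frac_le)
    also have "\<dots> \<le> real (Suc r) / real (f a0)"
      using A(2) f0 by (simp add: divide_right_mono)
    finally have "real (f a0) \<le> real (Suc r) / s"
      using \<open>0 < s\<close> f0 by (simp add: field_simps)
    then have m: "f a0 \<le> m" unfolding m_def by (simp add: le_nat_floor)
    \<comment> \<open>Summing over all \<open>k\<close> up to \<open>m\<close> covers the unknown
      value \<open>f a0\<close>; the term for \<open>k = 0\<close>, where \<open>1 / 0 = 0\<close>,
      can only enlarge the bound.\<close>
    show "f a \<le> m + (\<Sum>k\<le>m. Bd (s - 1 / real k))"
    proof (cases "a = a0")
      case False
      have "card (A - {a0}) \<le> r" using A a0(1) by simp
      moreover have "(\<Sum>b\<in>A - {a0}. 1 / real (f b)) = s - 1 / real (f a0)"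
        using s A(1) a0(1) by (simp add: sum_diff1)
      ultimately have "f a \<le> Bd (s - 1 / real (f a0))"
        using Bd[of "s - 1 / real (f a0)"] A(1) pos a False unfolding P_def by blast
      also have "\<dots> \<le> (\<Sum>k\<le>m. Bd (s - 1 / real k))"
        by (rule member_le_sum) (use m in auto)
      finally show ?thesis by simp
    qed (use m in simp)
  qed
qed

text \<open>Orbit-stabilizer for the twisted action: the group is partitioned into transporters from
  \<open>g\<close> to the points of its class.\<close>

lemma (in group_endo) card_class_mult_stabilizer:
  assumes fin: "finite (carrier G)" and g: "g \<in> carrier G"
  shows "card (twisted_conj_rel G \<psi> `` {g}) * card (twisted_stabilizer G \<psi> g) = card (carrier G)"
proof -
  have "carrier G = (\<Union>h\<in>twisted_conj_rel G \<psi> `` {g}. {x \<in> carrier G. twist G \<psi> x g = h})"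
    unfolding twisted_class_eq[OF g] by blast
  also have "card \<dots> = (\<Sum>h\<in>twisted_conj_rel G \<psi> `` {g}. card {x \<in> carrier G. twist G \<psi> x g = h})"
  proof (rule card_UN_disjoint)
    show "finite (twisted_conj_rel G \<psi> `` {g})" unfolding twisted_class_eq[OF g] using fin by simp
  qed (use fin in auto)
  also have "\<dots> = (\<Sum>h\<in>twisted_conj_rel G \<psi> `` {g}. card (twisted_stabilizer G \<psi> g))"
    unfolding twisted_class_eq[OF g] using card_transporter[OF g] by (intro sum.cong refl) blast
  finally show ?thesis by simp
qed

text \<open>Dividing the class equation by the group order makes the reciprocals of the stabilizer
  orders sum to 1, with one term per class. The bound on denominators then depends on
  \<open>r\<close> alone and serves all finite quotients at once.\<close>

lemma finite_group_stabilizers_bounded: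
  "\<exists>B. \<forall>(H :: ('a, 'b) monoid_scheme) \<psi> g. group_endo H \<psi> \<longrightarrow> finite (carrier H) \<longrightarrow>
    card (reidemeister_classes H \<psi>) \<le> r \<longrightarrow> g \<in> carrier H \<longrightarrow> card (twisted_stabilizer H \<psi> g) \<le> B"
proof -
  obtain B where "\<forall>(f :: 'a set \<Rightarrow> nat) A. finite A \<longrightarrow> card A \<le> r \<longrightarrow> (\<forall>a\<in>A. 0 < f a) \<longrightarrow>
    (\<Sum>a\<in>A. 1 / real (f a)) = 1 \<longrightarrow> (\<forall>a\<in>A. f a \<le> B)"
    using unit_fractions_bounded[of r 1] by (rule exE)
  note B = this[rule_format]
  show ?thesis
  proof (intro exI allI impI)
    fix H :: "('a, 'b) monoid_scheme" and \<psi> g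
    assume "group_endo H \<psi>" and fin: "finite (carrier H)"
      and r: "card (reidemeister_classes H \<psi>) \<le> r" and g: "g \<in> carrier H"
    interpret group_endo H \<psi> by fact
    let ?C = "reidemeister_classes H \<psi>"
    \<comment> \<open>This recovers the stabilizer order from the class, without a
      representative.\<close>
    define f where "f c = card (carrier H) div card c" for c :: "'a set"
    have f: "0 < f (twisted_conj_rel H \<psi> `` {x})"
      "f (twisted_conj_rel H \<psi> `` {x}) = card (twisted_stabilizer H \<psi> x)"
      "1 / f (twisted_conj_rel H \<psi> `` {x}) = card (twisted_conj_rel H \<psi> `` {x}) / card (carrier H)"
      if x: "x \<in> carrier H" for x
    proof -
      note prod = card_class_mult_stabilizer[OF fin x]
      have H: "card (carrier H) > 0" using fin x by (auto simp: card_gt_0_iff)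
      then have pos: "card (twisted_conj_rel H \<psi> `` {x}) > 0" "card (twisted_stabilizer H \<psi> x) > 0"
        using prod by (auto intro: Nat.gr0I)
      show eq: "f (twisted_conj_rel H \<psi> `` {x}) = card (twisted_stabilizer H \<psi> x)"
        unfolding f_def prod[symmetric] using pos by simp
      show "0 < f (twisted_conj_rel H \<psi> `` {x})" using eq pos by simp
      show "1 / f (twisted_conj_rel H \<psi> `` {x}) = card (twisted_conj_rel H \<psi> `` {x}) / card (carrier H)"
        unfolding eq prod[symmetric] using pos by simp
    qed
    have ball: "Q c" if "c \<in> ?C" "\<And>x. x \<in> carrier H \<Longrightarrow> Q (twisted_conj_rel H \<psi> `` {x})" for Q c
      using that unfolding reidemeister_classes_def by (auto elim: quotientE)
    have Un: "\<Union>?C = carrier H"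
      unfolding reidemeister_classes_def by (rule Union_quotient[OF equiv_rel])
    have finC: "finite ?C" using fin Un by (metis finite_UnionD)
    have "(\<Sum>c\<in>?C. 1 / real (f c)) = (\<Sum>c\<in>?C. card c / card (carrier H))"
      by (rule sum.cong) (auto intro: ball f(3))
    also have "\<dots> = real (\<Sum>c\<in>?C. card c) / card (carrier H)"
      by (simp add: sum_divide_distrib)
    also have "(\<Sum>c\<in>?C. card c) = card (\<Union>?C)"
    proof (rule card_Union_disjoint[symmetric])
      show "pairwise disjnt ?C"
        using quotient_disj[OF equiv_rel] unfolding reidemeister_classes_def pairwise_def disjnt_def by blast
      show "\<And>c. c \<in> ?C \<Longrightarrow> finite c" using fin Un by (metis Union_upper finite_subset)
    qed
    also have "real (card (\<Union>?C)) / card (carrier H) = 1"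
      using Un fin g by (auto simp: card_eq_0_iff)
    finally have "f (twisted_conj_rel H \<psi> `` {g}) \<le> B"
      using finC r g ball[where Q = "\<lambda>c. 0 < f c"] f(1)
      by (intro B[of ?C f]) (auto simp: reidemeister_classes_def quotientI)
    then show "card (twisted_stabilizer H \<psi> g) \<le> B" using f(2)[OF g] by simp
  qed
qed

text \<open>Used to bound a number of cosets: \<open>f\<close> sends an element to its coset, and
  \<open>g\<close> is a finite-valued map that determines the coset.\<close>

lemma finite_image_if_factors:
  assumes "finite (g ` A)" and "\<And>x y. x \<in> A \<Longrightarrow> y \<in> A \<Longrightarrow> g x = g y \<Longrightarrow> f x = f y"
  shows "finite (f ` A)" "card (f ` A) \<le> card (g ` A)"
proof -
  obtain h where h: "\<And>x. x \<in> A \<Longrightarrow> f x = h (g x)"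
    using assms(2) function_factors_left_gen[of "\<lambda>x. x \<in> A" g f] by metis
  have eq: "f ` A = h ` g ` A" using h by (auto simp: image_image)
  show "finite (f ` A)" unfolding eq using assms(1) by simp
  show "card (f ` A) \<le> card (g ` A)" unfolding eq by (rule card_image_le[OF assms(1)])
qed

section \<open>Subgroups of finite index\<close>

context group
begin

lemma rcosets_eq_image: "rcosets N = (\<lambda>x. N #> x) ` carrier G"
  by (auto simp: RCOSETS_def)

lemma rcos_eq_iff:
  assumes "subgroup N G" "x \<in> carrier G" "y \<in> carrier G"
  shows "N #> x = N #> y \<longleftrightarrow> x \<otimes> inv y \<in> N"
proof
  assume "N #> x = N #> y"
  then have "x \<in> N #> y" using rcos_self[OF assms(2,1)] by simp
  then show "x \<otimes> inv y \<in> N" using subgroup.rcos_module_imp[OF assms(1) is_group assms(3)] by blast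
next
  assume "x \<otimes> inv y \<in> N"
  then have "x \<in> N #> y" using subgroup.rcos_module_rev[OF assms(1) is_group assms(3,2)] by blast
  then show "N #> x = N #> y" using repr_independence[OF _ assms(3,1)] by simp
qed

text \<open>A subgroup of index at most \<open>k\<close> is determined by the right multiplication action of the
  generators on its cosets, labelled by numbers below \<open>k\<close>.\<close>

lemma finite_subgroups_of_bounded_index:
  assumes "finitely_generated_group G"
  shows "finite {M. subgroup M G \<and> finite (rcosets M) \<and> card (rcosets M) \<le> k}" (is "finite ?M")
proof -
  obtain S where S: "finite S" "S \<subseteq> carrier G" "generate G S = carrier G"
    using assms unfolding finitely_generated_group_def by blast
  \<comment> \<open>Inverses are included so that every basic step of \<open>generate\<close> is a
    right multiplication by an element of \<open>S'\<close>.\<close>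
  define S' where "S' = S \<union> (\<lambda>s. inv s) ` S"
  have S': "finite S'" "S' \<subseteq> carrier G" using S by (auto simp: S'_def)
  have "\<forall>M\<in>?M. \<exists>e :: 'a set \<Rightarrow> nat. inj_on e (rcosets M) \<and> e ` (rcosets M) \<subseteq> {..<k}"
  proof
    fix M assume "M \<in> ?M"
    then have M: "finite (rcosets M)" "card (rcosets M) \<le> k" by auto
    obtain e :: "'a set \<Rightarrow> nat" where "bij_betw e (rcosets M) {0..<card (rcosets M)}"
      using ex_bij_betw_finite_nat[OF M(1)] by (rule exE)
    then show "\<exists>e :: 'a set \<Rightarrow> nat. inj_on e (rcosets M) \<and> e ` (rcosets M) \<subseteq> {..<k}"
      using M(2) by (intro exI[of _ e]) (auto simp: bij_betw_def)
  qed
  from bchoice[OF this] obtain e :: "'a set \<Rightarrow> 'a set \<Rightarrow> nat"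
    where "\<forall>M\<in>?M. inj_on (e M) (rcosets M) \<and> e M ` (rcosets M) \<subseteq> {..<k}" by (rule exE)
  then have e: "inj_on (e M) (rcosets M)" "e M ` (rcosets M) \<subseteq> {..<k}" if "M \<in> ?M" for M
    using that by simp_all
  define l where "l M g = e M (M #> g)" for M g
  have l_eq: "l M g = l M h \<longleftrightarrow> M #> g = M #> h" if "M \<in> ?M" "g \<in> carrier G" "h \<in> carrier G" for M g h
    unfolding l_def by (rule inj_on_eq_iff[OF e(1)[OF that(1)]]) (use that in \<open>auto simp: rcosets_eq_image\<close>)
  have l_less: "l M g < k" if "M \<in> ?M" "g \<in> carrier G" for M g
    using e(2)[OF that(1)] that(2) unfolding l_def rcosets_eq_image by blast
  \<comment> \<open>The transition table of the labelled coset action. Together with the label of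
    the trivial coset it determines \<open>M\<close>.\<close>
  define T where "T M = {(s, l M g, l M (g \<otimes> s)) | s g. s \<in> S' \<and> g \<in> carrier G}" for M
  have "inj_on (\<lambda>M. (l M \<one>, T M)) ?M"
  proof (rule inj_onI)
    fix M N assume M: "M \<in> ?M" and N: "N \<in> ?M" and eq: "(l M \<one>, T M) = (l N \<one>, T N)"
    have step: "l M (h \<otimes> s) = l N (h \<otimes> s)"
      if h: "h \<in> carrier G" "l M h = l N h" and s: "s \<in> S'" for h s
    proof -
      have sG: "s \<in> carrier G" using s S' by blast
      have "(s, l M h, l M (h \<otimes> s)) \<in> T N" using h(1) s eq unfolding T_def by blast
      \<comment> \<open>The table of \<open>N\<close> supplies some \<open>g\<close> in place of
        \<open>h\<close>; equal labels put both in one coset of \<open>N\<close>, so their products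
        with \<open>s\<close> share a label too.\<close>
      then obtain g where g: "g \<in> carrier G" "l M h = l N g" "l M (h \<otimes> s) = l N (g \<otimes> s)"
        unfolding T_def by blast
      have NG: "N \<subseteq> carrier G" using N subgroup.subset by blast
      have "N #> g = N #> h" using l_eq[OF N g(1) h(1)] g(2) h(2) by simp
      then have "N #> (g \<otimes> s) = N #> (h \<otimes> s)"
        using coset_mult_assoc[OF NG g(1) sG] coset_mult_assoc[OF NG h(1) sG] by simp
      then show ?thesis using g(3) by (simp add: l_def)
    qed
    have "\<forall>h \<in> carrier G. l M h = l N h \<longrightarrow> l M (h \<otimes> g) = l N (h \<otimes> g)" if "g \<in> generate G S" for g
      using that
    proof induction
      case (eng g1 g2)
      then have "g1 \<in> carrier G" "g2 \<in> carrier G" using S by auto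
      then show ?case using eng.IH by (simp add: m_assoc[symmetric])
    qed (use step S in \<open>auto simp: S'_def\<close>)
    moreover have "l M \<one> = l N \<one>" using eq by simp
    ultimately have l: "l M g = l N g" if "g \<in> carrier G" for g using that S(3) by fastforce
    \<comment> \<open>The subgroup is read off from the labels as the set of elements labelled like
      \<open>\<one>\<close>.\<close>
    have mem: "g \<in> K \<longleftrightarrow> g \<in> carrier G \<and> l K g = l K \<one>" if K: "K \<in> ?M" for K g
    proof -
      have sub: "subgroup K G" using K by blast
      then show ?thesis
        using l_eq[OF K, of g \<one>] rcos_eq_iff[OF sub, of g \<one>] subgroup.mem_carrier[OF sub, of g] by auto
    qed
    show "M = N" using mem[OF M] mem[OF N] l by auto
  qed
  moreover have "(\<lambda>M. (l M \<one>, T M)) ` ?M \<subseteq> {..<k} \<times> Pow (S' \<times> {..<k} \<times> {..<k})"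
    using l_less S' by (fastforce simp: T_def)
  moreover have "finite ({..<k} \<times> Pow (S' \<times> {..<k} \<times> {..<k}))" using S' by simp
  ultimately show ?thesis by (rule inj_on_finite)
qed

lemma normal_Inter:
  assumes "\<And>N. N \<in> \<N> \<Longrightarrow> N \<lhd> G" "\<N> \<noteq> {}"
  shows "\<Inter>\<N> \<lhd> G"
  using assms subgroups_Inter[of \<N>] unfolding normal_inv_iff by blast

text \<open>A coset of the intersection is determined by the tuple of cosets of the members.\<close>

lemma finite_rcosets_Inter:
  assumes sub: "\<And>N. N \<in> \<N> \<Longrightarrow> subgroup N G" and fin: "finite \<N>" "\<N> \<noteq> {}"
    and ind: "\<And>N. N \<in> \<N> \<Longrightarrow> finite (rcosets N)"
  shows "finite (rcosets (\<Inter>\<N>))"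
proof -
  have "finite (PiE \<N> (\<lambda>N. rcosets N))" using fin ind by (intro finite_PiE) auto
  then have "finite ((\<lambda>x. \<lambda>N\<in>\<N>. N #> x) ` carrier G)"
    by (rule rev_finite_subset) (auto simp: rcosets_eq_image)
  then show ?thesis unfolding rcosets_eq_image
  proof (rule finite_image_if_factors(1))
    fix x y assume xy: "x \<in> carrier G" "y \<in> carrier G"
      and eq: "(\<lambda>N\<in>\<N>. N #> x) = (\<lambda>N\<in>\<N>. N #> y)"
    have "N #> x = N #> y" if "N \<in> \<N>" for N using fun_cong[OF eq, of N] that by simp
    then have "x \<otimes> inv y \<in> \<Inter>\<N>" using rcos_eq_iff[OF sub xy] by blast
    then show "\<Inter>\<N> #> x = \<Inter>\<N> #> y"
      using rcos_eq_iff[OF subgroups_Inter[OF sub] xy] fin(2) by blast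
  qed
qed

end

section \<open>Invariant normal subgroups and finite quotients\<close>

context group_endo
begin

lemma normal_preimage:
  assumes "N \<lhd> G"
  shows "{x \<in> carrier G. \<psi> x \<in> N} \<lhd> G" (is "?P \<lhd> G")
proof -
  have N: "subgroup N G" "\<And>x h. x \<in> carrier G \<Longrightarrow> h \<in> N \<Longrightarrow> x \<otimes> h \<otimes> inv x \<in> N"
    using assms unfolding normal_inv_iff by auto
  have "subgroup ?P G"
  proof (rule subgroupI)
    have "\<one> \<in> ?P" using subgroup.one_closed[OF N(1)] by simp
    then show "?P \<noteq> {}" by blast
  qed (use N(1) in \<open>auto simp: subgroup.m_closed subgroup.m_inv_closed\<close>)
  then show ?thesis unfolding normal_inv_iff using N(2) by auto
qed

text \<open>The coset of \<open>x\<close> modulo the preimage depends only on the coset of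
  \<open>\<psi> x\<close> modulo \<open>N\<close>. Consequently normal subgroups of bounded index
  are stable under preimages.\<close>

lemma rcosets_preimage:
  assumes "N \<lhd> G" "finite (rcosets N)"
  shows "finite (rcosets {x \<in> carrier G. \<psi> x \<in> N})"
    and "card (rcosets {x \<in> carrier G. \<psi> x \<in> N}) \<le> card (rcosets N)"
proof -
  let ?P = "{x \<in> carrier G. \<psi> x \<in> N}"
  have sub: "subgroup N G" "subgroup ?P G"
    using assms normal_preimage normal_imp_subgroup by auto
  have im: "(\<lambda>x. N #> \<psi> x) ` carrier G \<subseteq> rcosets N" by (auto simp: rcosets_eq_image)
  then have fin: "finite ((\<lambda>x. N #> \<psi> x) ` carrier G)" using assms(2) by (rule finite_subset)
  have eq: "?P #> x = ?P #> y" if "x \<in> carrier G" "y \<in> carrier G" "N #> \<psi> x = N #> \<psi> y" for x y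
    using that rcos_eq_iff[OF sub(1)] rcos_eq_iff[OF sub(2)] by simp
  show "finite (rcosets ?P)"
    unfolding rcosets_eq_image[of ?P] using finite_image_if_factors(1)[OF fin eq] .
  have "card (rcosets ?P) \<le> card ((\<lambda>x. N #> \<psi> x) ` carrier G)"
    unfolding rcosets_eq_image[of ?P] using finite_image_if_factors(2)[OF fin eq] .
  also have "\<dots> \<le> card (rcosets N)" by (rule card_mono[OF assms(2) im])
  finally show "card (rcosets ?P) \<le> card (rcosets N)" .
qed

text \<open>Take the intersection of all normal subgroups of index at most \<open>k\<close>, with
  \<open>k\<close> large enough to separate \<open>F\<close>. Finite generation makes this family
  finite, and its stability under preimages makes the intersection invariant.\<close>

lemma obtain_invariant_normal_separating:
  assumes fg: "finitely_generated_group G" and rf: "residually_finite_group G"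
    and F: "finite F" "F \<subseteq> carrier G"
  obtains N where "N \<lhd> G" "finite (rcosets N)" "\<psi> ` N \<subseteq> N" "inj_on (\<lambda>x. N #> x) F"
proof -
  \<comment> \<open>The coset map is injective on \<open>F\<close> once \<open>N\<close> avoids
    these quotients of distinct elements.\<close>
  define D where "D = {x \<otimes> inv y | x y. x \<in> F \<and> y \<in> F \<and> x \<noteq> y}"
  have D: "finite D" "D \<subseteq> carrier G" "\<one> \<notin> D"
  proof -
    have "D \<subseteq> (\<lambda>(x, y). x \<otimes> inv y) ` (F \<times> F)" unfolding D_def by auto
    then show "finite D" using F(1) by (meson finite_SigmaI finite_imageI finite_subset)
    show "D \<subseteq> carrier G" unfolding D_def using F(2) by auto
    have "x = y" if "x \<otimes> inv y = \<one>" "x \<in> carrier G" "y \<in> carrier G" for x y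
      using inv_equality[OF that(1)] that by simp
    then show "\<one> \<notin> D" unfolding D_def using F(2) by fastforce
  qed
  have "\<forall>d\<in>D. \<exists>N. N \<lhd> G \<and> finite (rcosets N) \<and> d \<notin> N"
  proof
    fix d assume "d \<in> D"
    then have "d \<in> carrier G" "d \<noteq> \<one>" using D by auto
    then show "\<exists>N. N \<lhd> G \<and> finite (rcosets N) \<and> d \<notin> N"
      using rf unfolding residually_finite_group_def by simp
  qed
  then obtain K where K: "\<And>d. d \<in> D \<Longrightarrow> K d \<lhd> G \<and> finite (rcosets (K d)) \<and> d \<notin> K d" by metis
  define k where "k = (\<Sum>d\<in>D. card (rcosets (K d)))"
  define \<N> where "\<N> = {M. M \<lhd> G \<and> finite (rcosets M) \<and> card (rcosets M) \<le> k}"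
  \<comment> \<open>The factor \<open>carrier G\<close> covers an empty family: if \<open>F\<close>
    has at most one element, then \<open>k\<close> is 0 and \<open>\<N>\<close> is empty.\<close>
  let ?N = "carrier G \<inter> \<Inter>\<N>"
  have Neq: "?N = \<Inter>(insert (carrier G) \<N>)" by simp
  have carrier_normal: "carrier G \<lhd> G" unfolding normal_inv_iff by (simp add: subgroup_self)
  have normal: "M \<lhd> G" if "M \<in> insert (carrier G) \<N>" for M
    using that carrier_normal by (auto simp: \<N>_def)
  have "finite \<N>"
    using finite_subgroups_of_bounded_index[OF fg, of k]
    by (rule rev_finite_subset) (auto simp: \<N>_def normal_imp_subgroup)
  moreover have "finite (rcosets (carrier G))"
  proof -
    have "rcosets (carrier G) \<subseteq> {carrier G}"
      unfolding rcosets_eq_image using coset_join2[OF _ subgroup_self] by auto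
    then show ?thesis by (rule finite_subset) simp
  qed
  ultimately have fins: "finite (insert (carrier G) \<N>)"
    "\<And>M. M \<in> insert (carrier G) \<N> \<Longrightarrow> finite (rcosets M)"
    by (auto simp: \<N>_def)
  have "finite (rcosets ?N)"
    unfolding Neq by (rule finite_rcosets_Inter[OF normal_imp_subgroup[OF normal] fins(1) _ fins(2)]) auto
  moreover have nN: "?N \<lhd> G" unfolding Neq using normal by (intro normal_Inter) auto
  moreover have "\<psi> ` ?N \<subseteq> ?N"
  proof (rule image_subsetI)
    fix x assume x: "x \<in> ?N"
    have "\<psi> x \<in> M" if "M \<in> \<N>" for M
    proof -
      have "{x \<in> carrier G. \<psi> x \<in> M} \<in> \<N>"
        using that normal_preimage[of M] rcosets_preimage[of M] unfolding \<N>_def by fastforce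
      then show ?thesis using x by blast
    qed
    then show "\<psi> x \<in> ?N" using x by auto
  qed
  moreover have "inj_on (\<lambda>x. ?N #> x) F"
  proof (rule inj_onI, rule ccontr)
    fix x y assume xy: "x \<in> F" "y \<in> F" "?N #> x = ?N #> y" "x \<noteq> y"
    let ?d = "x \<otimes> inv y"
    have d: "?d \<in> D" using xy unfolding D_def by blast
    then have "card (rcosets (K ?d)) \<le> k" unfolding k_def using D(1) by (intro member_le_sum) auto
    then have "K ?d \<in> \<N>" using K[OF d] by (simp add: \<N>_def)
    moreover have "?d \<in> ?N"
      using rcos_eq_iff[OF normal_imp_subgroup[OF nN], of x y] xy F(2) by blast
    ultimately show False using K[OF d] by blast
  qed
  ultimately show thesis using that by blast
qed

text \<open>The projection is compatible with twisting, so every class of the quotient is the image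
  of a class of \<open>G\<close>.\<close>

lemma card_classes_quotient_le:
  assumes N: "N \<lhd> G" and \<theta>: "\<theta> \<in> hom (G Mod N) (G Mod N)"
    and \<theta>_rcos: "\<And>x. x \<in> carrier G \<Longrightarrow> \<theta> (N #> x) = N #> \<psi> x"
    and fin: "finite (reidemeister_classes G \<psi>)"
  shows "group_endo (G Mod N) \<theta>"
    and "\<And>x g. x \<in> carrier G \<Longrightarrow> g \<in> carrier G \<Longrightarrow> twist (G Mod N) \<theta> (N #> x) (N #> g) = N #> twist G \<psi> x g"
    and "card (reidemeister_classes (G Mod N) \<theta>) \<le> card (reidemeister_classes G \<psi>)"
proof -
  interpret N: normal N G by (rule N)
  interpret Q: group_endo "G Mod N" \<theta>
    by (rule group_endo.intro[OF N.factorgroup_is_group], unfold_locales, rule \<theta>)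
  have carrier: "carrier (G Mod N) = (\<lambda>x. N #> x) ` carrier G"
    by (simp add: FactGroup_def rcosets_eq_image)
  show tw: "twist (G Mod N) \<theta> (N #> x) (N #> g) = N #> twist G \<psi> x g"
    if "x \<in> carrier G" "g \<in> carrier G" for x g
  proof -
    have "inv\<^bsub>G Mod N\<^esub> (N #> x) = N #> inv x"
      using that by (simp add: N.inv_FactGroup N.rcos_inv carrier)
    then show ?thesis using that by (simp add: twist_def \<theta>_rcos N.rcos_sum del: endo_inv)
  qed
  have "reidemeister_classes (G Mod N) \<theta> \<subseteq> (\<lambda>c. (\<lambda>x. N #> x) ` c) ` reidemeister_classes G \<psi>"
  proof
    fix c assume "c \<in> reidemeister_classes (G Mod N) \<theta>"
    then obtain g where g: "g \<in> carrier G" "c = twisted_conj_rel (G Mod N) \<theta> `` {N #> g}"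
      unfolding reidemeister_classes_def carrier by (auto elim!: quotientE)
    have Ng: "N #> g \<in> carrier (G Mod N)" using g(1) carrier by blast
    have "c = (\<lambda>x. twist (G Mod N) \<theta> (N #> x) (N #> g)) ` carrier G"
      unfolding g(2) Q.twisted_class_eq[OF Ng] carrier image_image ..
    also have "\<dots> = (\<lambda>x. N #> x) ` (twisted_conj_rel G \<psi> `` {g})"
      unfolding twisted_class_eq[OF g(1)] image_image using tw g(1) by (intro image_cong) auto
    finally show "c \<in> (\<lambda>c. (\<lambda>x. N #> x) ` c) ` reidemeister_classes G \<psi>"
      using g(1) by (auto simp: reidemeister_classes_def quotientI)
  qed
  then show "card (reidemeister_classes (G Mod N) \<theta>) \<le> card (reidemeister_classes G \<psi>)"
    using fin by (rule surj_card_le[rotated])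
  show "group_endo (G Mod N) \<theta>" by (rule Q.group_endo_axioms)
qed

text \<open>The bound \<open>B\<close> is fixed before the finite subset \<open>F\<close>. In a
  quotient that is injective on \<open>F\<close>, the image of \<open>F\<close> stabilizes the image
  of \<open>g\<close>, so \<open>F\<close> has at most \<open>B\<close> elements.\<close>

theorem finite_twisted_stabilizer:
  assumes fg: "finitely_generated_group G" and rf: "residually_finite_group G"
    and fin: "finite (reidemeister_classes G \<psi>)" and g: "g \<in> carrier G"
  shows "finite (twisted_stabilizer G \<psi> g)"
proof -
  obtain B where B: "\<And>(H :: 'a set monoid) \<theta> h. group_endo H \<theta> \<Longrightarrow> finite (carrier H) \<Longrightarrow>
    card (reidemeister_classes H \<theta>) \<le> card (reidemeister_classes G \<psi>) \<Longrightarrow> h \<in> carrier H \<Longrightarrow>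
    card (twisted_stabilizer H \<theta> h) \<le> B"
    using finite_group_stabilizers_bounded by metis
  have "card F \<le> B" if F: "finite F" "F \<subseteq> twisted_stabilizer G \<psi> g" for F
  proof -
    have FG: "F \<subseteq> carrier G" using F(2) by (auto simp: twisted_stabilizer_def)
    obtain N where N: "N \<lhd> G" "finite (rcosets N)" "\<psi> ` N \<subseteq> N" "inj_on (\<lambda>x. N #> x) F"
      by (rule obtain_invariant_normal_separating[OF fg rf F(1) FG])
    interpret N: normal N G by (rule N(1))
    have subN: "subgroup N G" by (rule N.is_subgroup)
    have "(\<lambda>x. N #> \<psi> x) \<in> hom G (G Mod N)"
      by (auto simp: hom_def FactGroup_def rcosets_eq_image N.rcos_sum)
    \<comment> \<open>Invariance of \<open>N\<close> lets \<open>\<psi>\<close> descend to the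
      quotient.\<close>
    moreover have "N #> \<psi> x = N #> \<psi> y" if xy: "x \<in> carrier G" "y \<in> carrier G" "N #> x = N #> y" for x y
    proof -
      have "x \<otimes> inv y \<in> N" using rcos_eq_iff[OF subN] xy by simp
      then have "\<psi> (x \<otimes> inv y) \<in> N" using N(3) by blast
      then show ?thesis using rcos_eq_iff[OF subN] xy by simp
    qed
    ultimately obtain \<theta> where \<theta>: "\<theta> \<in> hom (G Mod N) (G Mod N)"
      "\<And>x. x \<in> carrier G \<Longrightarrow> \<theta> (N #> x) = N #> \<psi> x"
      using FactGroup_universal[OF _ N(1)] by metis
    note quot = card_classes_quotient_le[OF N(1) \<theta> fin]
    have carrier: "carrier (G Mod N) = (\<lambda>x. N #> x) ` carrier G"
      by (simp add: FactGroup_def rcosets_eq_image)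
    have finQ: "finite (carrier (G Mod N))" using N(2) by (simp add: FactGroup_def)
    have "(\<lambda>x. N #> x) ` F \<subseteq> twisted_stabilizer (G Mod N) \<theta> (N #> g)"
    proof (rule image_subsetI)
      fix x assume "x \<in> F"
      then have "x \<in> carrier G" "twist G \<psi> x g = g" using F(2) by (auto simp: twisted_stabilizer_def)
      then show "N #> x \<in> twisted_stabilizer (G Mod N) \<theta> (N #> g)"
        using quot(2)[of x g] g by (simp add: twisted_stabilizer_def carrier)
    qed
    moreover have "finite (twisted_stabilizer (G Mod N) \<theta> (N #> g))"
      using finQ by (rule rev_finite_subset) (auto simp: twisted_stabilizer_def)
    ultimately have "card ((\<lambda>x. N #> x) ` F) \<le> card (twisted_stabilizer (G Mod N) \<theta> (N #> g))"
      by (intro card_mono)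
    also have "\<dots> \<le> B" using quot(1,3) finQ g by (intro B) (auto simp: carrier)
    finally show ?thesis using card_image[OF N(4)] by simp
  qed
  then show ?thesis using finite_if_finite_subsets_card_bdd[of "twisted_stabilizer G \<psi> g" B] by blast
qed

end

section \<open>Gauss congruences for Reidemeister numbers\<close>

lemma hom_funpow:
  assumes "\<phi> \<in> hom G G"
  shows "\<phi> ^^ k \<in> hom G G"
proof (induction k)
  case 0
  then show ?case by (auto simp: hom_def)
next
  case (Suc k)
  then show ?case using assms by (auto simp: hom_def Pi_iff)
qed

text \<open>The witness is the \<open>m\<close>-th power of \<open>w t\<close> in the mapping torus, with its power of \<open>t\<close> removed.\<close>

lemma (in group_endo) ex_commuting_with_power:
  assumes w: "w \<in> carrier G"
  shows "\<exists>u \<in> carrier G. w \<otimes> \<psi> u = u \<otimes> (\<psi> ^^ m) w"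
proof (induction m)
  case 0
  then show ?case using w by (intro bexI[of _ \<one>]) auto
next
  case (Suc m)
  then obtain u where u: "u \<in> carrier G" "w \<otimes> \<psi> u = u \<otimes> (\<psi> ^^ m) w" by blast
  have c: "(\<psi> ^^ k) w \<in> carrier G" for k by (induction k) (use w in auto)
  have "w \<otimes> \<psi> (w \<otimes> \<psi> u) = w \<otimes> \<psi> (u \<otimes> (\<psi> ^^ m) w)" using u(2) by simp
  also have "\<dots> = (w \<otimes> \<psi> u) \<otimes> (\<psi> ^^ Suc m) w" using w u(1) c[of m] by (simp add: m_assoc)
  finally show ?case using w u(1) by (intro bexI[of _ "w \<otimes> \<psi> u"]) auto
qed

theorem mainTheorem3:
  fixes G :: "('a, 'b) monoid_scheme" and \<phi> :: "'a \<Rightarrow> 'a"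
  assumes "group G"
    and "finitely_generated_group G"
    and "residually_finite_group G"
    and "\<phi> \<in> iso G G"
    and "\<And>n::nat. n \<ge> 1 \<Longrightarrow> finite (reidemeister_classes G (\<phi> ^^ n))"
  shows "\<forall>n::nat. n \<ge> 1 \<longrightarrow>
    [(\<Sum>d | d dvd n. moebius d * int (reidemeister_number G (\<phi> ^^ (n div d)))) = 0] (mod int n)"
proof (intro allI impI)
  fix n :: nat assume n: "n \<ge> 1"
  interpret group G by fact
  have hom: "\<phi> ^^ k \<in> hom G G" for k
    using assms(4) by (intro hom_funpow) (simp add: iso_def)
  have iter_endo: "group_endo G (\<phi> ^^ k)" for k by unfold_locales (rule hom)
  have surj: "(\<phi> ^^ k) ` carrier G = carrier G" for k
  proof (induction k)
    case (Suc k)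
    have "\<phi> ` carrier G = carrier G" using assms(4) by (auto simp: iso_def bij_betw_def)
    then show ?case using Suc by (simp only: funpow.simps image_comp[symmetric])
  qed simp
  have stab: "finite (twisted_stabilizer G (\<phi> ^^ k) g)" if "k \<ge> 1" "g \<in> carrier G" for k g
    using group_endo.finite_twisted_stabilizer[OF iter_endo assms(2,3) assms(5)[OF that(1)] that(2)] .
  let ?C = "reidemeister_classes G (\<phi> ^^ n)"
  \<comment> \<open>The permutation of the classes is direct image under \<open>\<phi>\<close>; its
    iterates are direct images under iterates of \<open>\<phi>\<close>.\<close>
  have im_funpow: "((`) \<phi> ^^ k) c = (\<phi> ^^ k) ` c" for k c
    by (induction k) (simp_all add: image_comp)
  have number: "reidemeister_number G (\<phi> ^^ k) = card {c \<in> ?C. ((`) \<phi> ^^ k) c = c}"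
    if k: "k \<ge> 1" "k dvd n" for k
  proof -
    obtain m where m: "n = k * m" using k(2) by auto
    have comm: "(\<phi> ^^ a) ((\<phi> ^^ b) x) = (\<phi> ^^ b) ((\<phi> ^^ a) x)" for a b x
      by (metis add.commute comp_apply funpow_add)
    interpret k: group_endo G "\<phi> ^^ k" by (rule iter_endo)
    interpret commuting_endos G "\<phi> ^^ k" "\<phi> ^^ n"
      by (intro commuting_endos.intro commuting_endos_axioms.intro iter_endo comm)
    \<comment> \<open>As \<open>n = k * m\<close>, the \<open>m\<close>-th iterate of
      \<open>\<phi> ^^ k\<close> is \<open>\<phi> ^^ n\<close>.\<close>
    have "\<exists>u\<in>carrier G. commuting_pair w u" if "w \<in> carrier G" for w
      using k.ex_commuting_with_power[OF that, of m, unfolded funpow_mult, folded m]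
      unfolding commuting_pair_def .
    then show ?thesis
      unfolding im_funpow using assms(5) stab surj k(1) n
      by (intro reidemeister_number_eq_fixed_classes) auto
  qed
  have "[(\<Sum>d | d dvd n. moebius d * int (card {c \<in> ?C. ((`) \<phi> ^^ (n div d)) c = c})) = 0] (mod int n)"
  proof (rule gauss_congruence_permutation)
    interpret group_endo G "\<phi> ^^ n" by (rule iter_endo)
    interpret \<phi>: group_endo G \<phi> using iter_endo[of 1] by simp
    have class_image: "\<phi> ` (twisted_conj_rel G (\<phi> ^^ n) `` {g}) = twisted_conj_rel G (\<phi> ^^ n) `` {\<phi> g}"
      if g: "g \<in> carrier G" for g
    proof -
      have "\<phi> (twist G (\<phi> ^^ n) x g) = twist G (\<phi> ^^ n) (\<phi> x) (\<phi> g)" if "x \<in> carrier G" for x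
        using that g by (simp add: twist_def funpow_swap1)
      then have "\<phi> ` (twisted_conj_rel G (\<phi> ^^ n) `` {g}) = (\<lambda>x. twist G (\<phi> ^^ n) x (\<phi> g)) ` \<phi> ` carrier G"
        unfolding twisted_class_eq[OF g] image_image by (intro image_cong) auto
      then show ?thesis using surj[of 1] g by (simp add: twisted_class_eq)
    qed
    show "(`) \<phi> ` ?C \<subseteq> ?C"
    proof (rule image_subsetI)
      fix c assume "c \<in> ?C"
      then obtain g where g: "g \<in> carrier G" "c = twisted_conj_rel G (\<phi> ^^ n) `` {g}"
        by (auto simp: reidemeister_classes_def quotient_def)
      then show "\<phi> ` c \<in> ?C"
        using class_image[OF g(1)] \<phi>.endo_closed[OF g(1)]
        by (simp add: reidemeister_classes_def quotientI)
    qed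
    fix c assume "c \<in> ?C"
    then obtain g where g: "g \<in> carrier G" "c = twisted_conj_rel G (\<phi> ^^ n) `` {g}"
      by (auto simp: reidemeister_classes_def quotient_def)
    show "((`) \<phi> ^^ n) c = c"
    proof -
      have iter: "((`) \<phi> ^^ k) c = twisted_conj_rel G (\<phi> ^^ n) `` {(\<phi> ^^ k) g} \<and> (\<phi> ^^ k) g \<in> carrier G" for k
        by (induction k) (use g class_image in auto)
      \<comment> \<open>Twisting \<open>g\<close> by its own inverse gives
        \<open>(\<phi> ^^ n) g\<close>, so \<open>\<phi> ^^ n\<close> fixes each of its own
        classes.\<close>
      have "(\<phi> ^^ n) g = twist G (\<phi> ^^ n) (inv\<^bsub>G\<^esub> g) g" using g(1) by (simp add: twist_def)
      then have "(g, (\<phi> ^^ n) g) \<in> twisted_conj_rel G (\<phi> ^^ n)"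
        unfolding twisted_conj_rel_iff using g(1) inv_closed by blast
      then show ?thesis using iter[of n] g(2) equiv_class_eq[OF equiv_rel] by metis
    qed
  qed (use n assms(5) in auto)
  moreover have "(\<Sum>d | d dvd n. moebius d * int (card {c \<in> ?C. ((`) \<phi> ^^ (n div d)) c = c}))
      = (\<Sum>d | d dvd n. moebius d * int (reidemeister_number G (\<phi> ^^ (n div d))))"
  proof (rule sum.cong)
    fix d assume "d \<in> {d. d dvd n}"
    then have "n div d \<ge> 1" "n div d dvd n"
      using n by (auto simp: Suc_le_eq dvd_div_eq_0_iff intro: Nat.gr0I div_dvd_iff_mult[THEN iffD2])
    then show "moebius d * int (card {c \<in> ?C. ((`) \<phi> ^^ (n div d)) c = c})
        = moebius d * int (reidemeister_number G (\<phi> ^^ (n div d)))"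
      using number by simp
  qed simp
  ultimately show "[(\<Sum>d | d dvd n. moebius d * int (reidemeister_number G (\<phi> ^^ (n div d)))) = 0] (mod int n)"
    by simp
qed

end
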